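(* Let $G$ be the directed graph with a single vertex $\phi$ and two loop edges $e$ and $f$. Define a path weight $\alpha:G^+\to(0,\infty)$ recursively by $\alpha(\phi)=\alpha(e)=\alpha(f)=1$ and, for all $w\in G^+$, $$\alpha(ewe)=\tfrac12\alpha(we),\quad \alpha(fwf)=\tfrac12\alpha(wf),\quad \alpha(ewf)=\alpha(wf),\quad \alpha(fwe)=\alpha(we).$$ Let $\lambda=\lambda_\alpha$ be the left weight $\lambda(v,w)=\alpha(wv)/\alpha(v)$ $(v,w\in G^+)$. Then $\lambda$ is left-bounded and $\mathfrak{L}(G,\lambda)''=\mathcal{B}(\mathcal{H}_G)\neq\mathfrak{L}(G,\lambda)$.
   Context: $G^+$ is the set of all finite paths in $G$, including the vertex $\phi$ as the path of length $0$; here $G^+$ is the set of all finite words in $e,f$, with $\phi$ the empty word, and the product is concatenation. $\mathcal{H}_G=\ell^2(G^+)$ with canonical orthonormal basis $\{\xi_v : v\in G^+\}$; commutants are taken in $\mathcal{B}(\mathcal{H}_G)$. A path weight on this graph is a function $\alpha:G^+\to(0,\infty)$ with $\alpha(\phi)=1$. A left weight on this graph is a function $\lambda:G^+\times G^+\to[0,\infty)$ with $\lambda(v,w)>0$ for all $v,w$ and $\lambda(v,w_2w_1)=\lambda(w_1v,w_2)\lambda(v,w_1)$ for all $v,w_1,w_2\in G^+$. Put $\lambda(w)=\sup_{v\in G^+}\lambda(v,w)\in[0,\infty]$; $\lambda$ is left-bounded if $\lambda(w)<\infty$ for all $w\in G^+$. If $\lambda(w)<\infty$, $L_{\lambda,w}\in\mathcal{B}(\mathcal{H}_G)$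 is the bounded operator with $L_{\lambda,w}\xi_v=\lambda(v,w)\xi_{wv}$ for all $v\in G^+$. $\mathfrak{L}(G,\lambda)$ is the WOT-closed unital operator algebra generated by $\{L_{\lambda,w}: w\in G^+,\ \lambda(w)<\infty\}$. *)

theory Defs
  imports "HOL-Analysis.Analysis"
begin

section \<open>The complex Hilbert space of square-summable functions\<close>

typedef 'a ell2 = "{x :: 'a \<Rightarrow> complex. (\<lambda>i. (cmod (x i))\<^sup>2) summable_on UNIV}"
  morphisms coord Abs_ell2
  by (rule exI[of _ "\<lambda>_. 0"]) simp

setup_lifting type_definition_ell2

lemma ell2_summable: "(\<lambda>i. (cmod (coord x i))\<^sup>2) summable_on UNIV"
  using coord[of x] by simp

lemma ell2_eqI: "(\<And>i. coord x i = coord y i) \<Longrightarrow> x = y"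
  by (metis coord_inject ext)

lemma cmod_add_square_le: "(cmod (a + b))\<^sup>2 \<le> 2 * (cmod a)\<^sup>2 + 2 * (cmod b)\<^sup>2"
proof -
  have "(cmod (a + b))\<^sup>2 \<le> (cmod a + cmod b)\<^sup>2"
    by (intro power_mono norm_triangle_ineq) auto
  also have "\<dots> \<le> 2 * (cmod a)\<^sup>2 + 2 * (cmod b)\<^sup>2"
    using zero_le_power2[of "cmod a - cmod b"] unfolding power2_sum power2_diff by linarith
  finally show ?thesis .
qed

lemma ell2_add_closed:
  assumes "(\<lambda>i. (cmod (x i))\<^sup>2) summable_on UNIV" "(\<lambda>i. (cmod (y i))\<^sup>2) summable_on UNIV"
  shows "(\<lambda>i. (cmod (x i + y i))\<^sup>2) summable_on UNIV"
proof (rule summable_on_comparison_test)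
  show "(\<lambda>i. 2 * (cmod (x i))\<^sup>2 + 2 * (cmod (y i))\<^sup>2) summable_on UNIV"
    by (intro summable_on_add summable_on_cmult_right assms)
qed (use cmod_add_square_le in auto)

lemma ell2_scale_closed:
  assumes "(\<lambda>i. (cmod (x i))\<^sup>2) summable_on UNIV"
  shows "(\<lambda>i. (cmod (c * x i))\<^sup>2) summable_on UNIV"
  using summable_on_cmult_right[OF assms, of "(cmod c)\<^sup>2"]
  by (simp add: norm_mult power_mult_distrib)

lift_definition cscale :: "complex \<Rightarrow> 'a ell2 \<Rightarrow> 'a ell2" (infixr "*\<^sub>C" 75)
  is "\<lambda>c x i. c * x i"
  by (rule ell2_scale_closed)

text \<open>Linear in the first argument.\<close>

definition cinner :: "'a ell2 \<Rightarrow> 'a ell2 \<Rightarrow> complex" where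
  "cinner x y = (\<Sum>\<^sub>\<infinity>i. coord x i * cnj (coord y i))"

lift_definition ket :: "'a \<Rightarrow> 'a ell2" is "\<lambda>v i. if i = v then 1 else 0"
  by (rule finite_nonzero_values_imp_summable_on) (auto intro: finite_subset[of _ "{_}"])

lemma cinner_summable: "(\<lambda>i. coord x i * cnj (coord y i)) summable_on UNIV"
proof (rule abs_summable_summable, rule summable_on_comparison_test)
  show "(\<lambda>i. (cmod (coord x i))\<^sup>2 + (cmod (coord y i))\<^sup>2) summable_on UNIV"
    by (intro summable_on_add ell2_summable)
  fix i
  have "2 * (cmod (coord x i) * cmod (coord y i)) \<le> (cmod (coord x i))\<^sup>2 + (cmod (coord y i))\<^sup>2"
    using zero_le_power2[of "cmod (coord x i) - cmod (coord y i)"] unfolding power2_diff by linarith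
  moreover have "0 \<le> cmod (coord x i) * cmod (coord y i)" by simp
  ultimately have "cmod (coord x i) * cmod (coord y i) \<le> (cmod (coord x i))\<^sup>2 + (cmod (coord y i))\<^sup>2"
    by linarith
  then show "norm (coord x i * cnj (coord y i)) \<le> (cmod (coord x i))\<^sup>2 + (cmod (coord y i))\<^sup>2"
    by (simp add: norm_mult)
qed auto

lemma cinner_self: "cinner x x = complex_of_real (\<Sum>\<^sub>\<infinity>i. (cmod (coord x i))\<^sup>2)"
proof -
  have "((\<lambda>i. complex_of_real ((cmod (coord x i))\<^sup>2)) has_sum
      complex_of_real (\<Sum>\<^sub>\<infinity>i. (cmod (coord x i))\<^sup>2)) UNIV"
    by (intro has_sum_of_real has_sum_infsum ell2_summable)
  then show ?thesis
    unfolding cinner_def by (simp add: infsumI complex_norm_square[symmetric])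
qed

instantiation ell2 :: (type) real_vector
begin

lift_definition zero_ell2 :: "'a ell2" is "\<lambda>_. 0" by simp
lift_definition plus_ell2 :: "'a ell2 \<Rightarrow> 'a ell2 \<Rightarrow> 'a ell2" is "\<lambda>x y i. x i + y i"
  by (rule ell2_add_closed)
lift_definition uminus_ell2 :: "'a ell2 \<Rightarrow> 'a ell2" is "\<lambda>x i. - x i" by simp
lift_definition minus_ell2 :: "'a ell2 \<Rightarrow> 'a ell2 \<Rightarrow> 'a ell2" is "\<lambda>x y i. x i - y i"
  subgoal for x y using ell2_add_closed[of x "\<lambda>i. - y i"] by simp
  done
lift_definition scaleR_ell2 :: "real \<Rightarrow> 'a ell2 \<Rightarrow> 'a ell2" is "\<lambda>r x i. complex_of_real r * x i"
  by (rule ell2_scale_closed)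

instance
proof
  fix x y z :: "'a ell2" and r s :: real
  show "x + y + z = x + (y + z)" by transfer (simp add: add.assoc)
  show "x + y = y + x" by transfer (simp add: add.commute)
  show "0 + x = x" by transfer simp
  show "- x + x = 0" by transfer simp
  show "x - y = x + - y" by transfer simp
  show "r *\<^sub>R (x + y) = r *\<^sub>R x + r *\<^sub>R y" by transfer (simp add: algebra_simps)
  show "(r + s) *\<^sub>R x = r *\<^sub>R x + s *\<^sub>R x" by transfer (simp add: algebra_simps)
  show "r *\<^sub>R s *\<^sub>R x = (r * s) *\<^sub>R x" by transfer (simp add: algebra_simps)
  show "1 *\<^sub>R x = x" by transfer simp
qed

end

instantiation ell2 :: (type) real_inner
begin

definition inner_ell2 :: "'a ell2 \<Rightarrow> 'a ell2 \<Rightarrow> real" where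
  "inner_ell2 x y = Re (cinner x y)"
definition norm_ell2 :: "'a ell2 \<Rightarrow> real" where
  "norm_ell2 x = sqrt (\<Sum>\<^sub>\<infinity>i. (cmod (coord x i))\<^sup>2)"
definition sgn_ell2 :: "'a ell2 \<Rightarrow> 'a ell2" where
  "sgn_ell2 x = x /\<^sub>R norm x"
definition dist_ell2 :: "'a ell2 \<Rightarrow> 'a ell2 \<Rightarrow> real" where
  "dist_ell2 x y = norm (x - y)"
definition uniformity_ell2 :: "('a ell2 \<times> 'a ell2) filter" where
  "uniformity_ell2 = (INF e\<in>{0<..}. principal {(x, y). dist x y < e})"
definition open_ell2 :: "'a ell2 set \<Rightarrow> bool" where
  "open_ell2 U = (\<forall>x\<in>U. eventually (\<lambda>(x', y). x' = x \<longrightarrow> y \<in> U) uniformity)"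

instance
proof
  fix x y z :: "'a ell2" and r :: real
  show "sgn x = x /\<^sub>R norm x" by (rule sgn_ell2_def)
  show "dist x y = norm (x - y)" by (rule dist_ell2_def)
  show "(uniformity :: ('a ell2 \<times> 'a ell2) filter) = (INF e\<in>{0<..}. principal {(x, y). dist x y < e})"
    by (rule uniformity_ell2_def)
  show "open U \<longleftrightarrow> (\<forall>x\<in>U. eventually (\<lambda>(x', y). x' = x \<longrightarrow> y \<in> U) uniformity)" for U :: "'a ell2 set"
    by (rule open_ell2_def)
  have "cinner y x = cnj (cinner x y)"
    unfolding cinner_def infsum_cnj[symmetric] by (simp add: mult.commute)
  then show "inner x y = inner y x" by (simp add: inner_ell2_def)
  have "cinner (x + y) z = cinner x z + cinner y z"
    using infsum_add[OF cinner_summable[of x z] cinner_summable[of y z]]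
    by (simp add: cinner_def plus_ell2.rep_eq distrib_right)
  then show "inner (x + y) z = inner x z + inner y z" by (simp add: inner_ell2_def)
  have "cinner (r *\<^sub>R x) y = complex_of_real r * cinner x y"
    using infsum_cmult_right'[of "complex_of_real r" "\<lambda>i. coord x i * cnj (coord y i)" UNIV]
    by (simp add: cinner_def scaleR_ell2.rep_eq mult.assoc)
  then show "inner (r *\<^sub>R x) y = r * inner x y" by (simp add: inner_ell2_def)
  show "0 \<le> inner x x" by (simp add: inner_ell2_def cinner_self infsum_nonneg)
  show "inner x x = 0 \<longleftrightarrow> x = 0"
  proof
    assume "inner x x = 0"
    then have "(\<Sum>\<^sub>\<infinity>i. (cmod (coord x i))\<^sup>2) \<le> 0" by (simp add: inner_ell2_def cinner_self)
    then have "(cmod (coord x i))\<^sup>2 = 0" for i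
      using nonneg_infsum_le_0D[OF _ ell2_summable[of x], of i] by simp
    then show "x = 0" by (intro ell2_eqI) (simp add: zero_ell2.rep_eq)
  next
    assume "x = 0"
    then show "inner x x = 0" by (simp add: inner_ell2_def cinner_def zero_ell2.rep_eq)
  qed
  show "norm x = sqrt (inner x x)" by (simp add: norm_ell2_def inner_ell2_def cinner_self)
qed

end


section \<open>Bounded operators, weak operator topology, commutants\<close>

text \<open>The library type of bounded linear maps is real-linear, so complex homogeneity is required
  explicitly.\<close>

definition bounded_operators :: "('a ell2 \<Rightarrow>\<^sub>L 'a ell2) set" where
  "bounded_operators = {T. \<forall>c x. blinfun_apply T (c *\<^sub>C x) = c *\<^sub>C blinfun_apply T x}"

lemma bounded_linear_cscale: "bounded_linear (cscale c)"
proof (rule bounded_linear_intro[of _ "cmod c"])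
  fix x y :: "'a ell2" and r :: real
  show "c *\<^sub>C (x + y) = c *\<^sub>C x + c *\<^sub>C y" by transfer (simp add: distrib_left)
  show "c *\<^sub>C (r *\<^sub>R x) = r *\<^sub>R (c *\<^sub>C x)" by transfer (simp add: algebra_simps)
  show "norm (c *\<^sub>C x) \<le> norm x * cmod c"
    by (simp add: norm_ell2_def cscale.rep_eq norm_mult power_mult_distrib infsum_cmult_right'
        real_sqrt_mult)
qed

definition cscale_op :: "complex \<Rightarrow> ('a ell2 \<Rightarrow>\<^sub>L 'a ell2) \<Rightarrow> ('a ell2 \<Rightarrow>\<^sub>L 'a ell2)" where
  "cscale_op c T = Blinfun (\<lambda>x. c *\<^sub>C blinfun_apply T x)"

lemma cscale_op_apply: "blinfun_apply (cscale_op c T) x = c *\<^sub>C blinfun_apply T x"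
  unfolding cscale_op_def
  by (simp add: bounded_linear_Blinfun_apply
      bounded_linear_compose[OF bounded_linear_cscale blinfun.bounded_linear_right])

definition weak_operator_topology :: "('a ell2 \<Rightarrow>\<^sub>L 'a ell2) topology" where
  "weak_operator_topology =
     pullback_topology bounded_operators (\<lambda>T (x, y). cinner (blinfun_apply T x) y) euclidean"

definition unital_operator_algebra :: "('a ell2 \<Rightarrow>\<^sub>L 'a ell2) set \<Rightarrow> bool" where
  "unital_operator_algebra A \<longleftrightarrow>
     A \<subseteq> bounded_operators \<and> id_blinfun \<in> A \<and>
     (\<forall>S\<in>A. \<forall>T\<in>A. S + T \<in> A) \<and> (\<forall>c. \<forall>T\<in>A. cscale_op c T \<in> A) \<and>
     (\<forall>S\<in>A. \<forall>T\<in>A. S o\<^sub>L T \<in> A)"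

definition wot_closed_algebra_generated_by ::
    "('a ell2 \<Rightarrow>\<^sub>L 'a ell2) set \<Rightarrow> ('a ell2 \<Rightarrow>\<^sub>L 'a ell2) set" where
  "wot_closed_algebra_generated_by X =
     \<Inter>{A. unital_operator_algebra A \<and> closedin weak_operator_topology A \<and> X \<subseteq> A}"

definition commutant :: "('a ell2 \<Rightarrow>\<^sub>L 'a ell2) set \<Rightarrow> ('a ell2 \<Rightarrow>\<^sub>L 'a ell2) set" where
  "commutant X = {T \<in> bounded_operators. \<forall>S\<in>X. T o\<^sub>L S = S o\<^sub>L T}"


section \<open>Weights on the graph with one vertex and two loops\<close>

datatype edge = E | F

text \<open>A path is a word of edges, written as a list; \<^term>\<open>[]\<close> is the vertex.\<close>

type_synonym path = "edge list"

definition path_weight :: "(path \<Rightarrow> real) \<Rightarrow> bool" where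
  "path_weight \<alpha> \<longleftrightarrow> (\<forall>v. \<alpha> v > 0) \<and> \<alpha> [] = 1"

definition left_weight :: "(path \<Rightarrow> path \<Rightarrow> real) \<Rightarrow> bool" where
  "left_weight lam \<longleftrightarrow>
     (\<forall>v w. lam v w > 0) \<and>
     (\<forall>v w1 w2. lam v (w2 @ w1) = lam (w1 @ v) w2 * lam v w1)"

definition weight_sup :: "(path \<Rightarrow> path \<Rightarrow> real) \<Rightarrow> path \<Rightarrow> ennreal" where
  "weight_sup lam w = (SUP v. ennreal (lam v w))"

definition left_bounded :: "(path \<Rightarrow> path \<Rightarrow> real) \<Rightarrow> bool" where
  "left_bounded lam \<longleftrightarrow> (\<forall>w. weight_sup lam w < \<infinity>)"

definition left_weight_of :: "(path \<Rightarrow> real) \<Rightarrow> path \<Rightarrow> path \<Rightarrow> real" where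
  "left_weight_of \<alpha> v w = \<alpha> (w @ v) / \<alpha> v"

definition left_shift :: "(path \<Rightarrow> path \<Rightarrow> real) \<Rightarrow> path \<Rightarrow> (path ell2 \<Rightarrow>\<^sub>L path ell2)" where
  "left_shift lam w =
     (THE T. T \<in> bounded_operators \<and> (\<forall>v. blinfun_apply T (ket v) = lam v w *\<^sub>R ket (w @ v)))"

definition left_weighted_algebra :: "(path \<Rightarrow> path \<Rightarrow> real) \<Rightarrow> (path ell2 \<Rightarrow>\<^sub>L path ell2) set" where
  "left_weighted_algebra lam =
     wot_closed_algebra_generated_by {left_shift lam w | w. weight_sup lam w < \<infinity>}"


section \<open>The definitions are meaningful\<close>

lemma left_weight_left_weight_of:
  assumes "path_weight \<alpha>"
  shows "left_weight (left_weight_of \<alpha>)"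
proof -
  have pos: "\<alpha> v > 0" for v using assms by (simp add: path_weight_def)
  have "\<alpha> v \<noteq> 0" for v using pos[of v] by simp
  then show ?thesis
    using pos by (simp add: left_weight_def left_weight_of_def)
qed

lemma ket_expansion: "((\<lambda>i. coord x i *\<^sub>C ket i) has_sum x) UNIV"
proof -
  let ?N = "\<lambda>i. (cmod (coord x i))\<^sup>2"
  have co: "coord (\<Sum>i\<in>G. coord x i *\<^sub>C ket i) j = (if j \<in> G then coord x j else 0)"
    if "finite G" for G j
    using that by (induction G rule: finite_induct)
      (auto simp: zero_ell2.rep_eq plus_ell2.rep_eq cscale.rep_eq ket.rep_eq)
  have n: "norm ((\<Sum>i\<in>G. coord x i *\<^sub>C ket i) - x) = sqrt (infsum ?N UNIV - sum ?N G)"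
    if "finite G" for G
  proof -
    have "((\<lambda>j. ?N j + - (if j \<in> G then ?N j else 0)) has_sum (infsum ?N UNIV + - sum ?N G)) UNIV"
    proof (rule has_sum_add)
      show "(?N has_sum infsum ?N UNIV) UNIV" using ell2_summable by (rule has_sum_infsum)
      have "((\<lambda>j. if j \<in> G then ?N j else 0) has_sum sum ?N G) UNIV"
        using has_sum_finite[OF that, of ?N] by (rule has_sum_cong_neutral[THEN iffD1, rotated -1]) auto
      then show "((\<lambda>j. - (if j \<in> G then ?N j else 0)) has_sum - sum ?N G) UNIV"
        by (rule has_sum_uminusI)
    qed
    moreover have "(\<lambda>j. ?N j + - (if j \<in> G then ?N j else 0)) =
        (\<lambda>j. (cmod (coord ((\<Sum>i\<in>G. coord x i *\<^sub>C ket i) - x) j))\<^sup>2)"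
      by (auto simp: minus_ell2.rep_eq co[OF that])
    ultimately show ?thesis unfolding norm_ell2_def by (simp add: infsumI)
  qed
  have "((\<lambda>G. sum ?N G) \<longlongrightarrow> infsum ?N UNIV) (finite_subsets_at_top UNIV)"
    using ell2_summable by (rule infsum_tendsto)
  then have "((\<lambda>G. sqrt (infsum ?N UNIV - sum ?N G)) \<longlongrightarrow> sqrt (infsum ?N UNIV - infsum ?N UNIV))
      (finite_subsets_at_top UNIV)"
    by (intro tendsto_intros)
  moreover have "\<forall>\<^sub>F G in finite_subsets_at_top UNIV. sqrt (infsum ?N UNIV - sum ?N G) =
      norm ((\<Sum>i\<in>G. coord x i *\<^sub>C ket i) - x)"
    by (rule eventually_finite_subsets_at_top_weakI) (simp add: n)
  ultimately have "((\<lambda>G. norm ((\<Sum>i\<in>G. coord x i *\<^sub>C ket i) - x)) \<longlongrightarrow>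
      sqrt (infsum ?N UNIV - infsum ?N UNIV)) (finite_subsets_at_top UNIV)"
    by (rule Lim_transform_eventually)
  then have "((\<lambda>G. norm ((\<Sum>i\<in>G. coord x i *\<^sub>C ket i) - x)) \<longlongrightarrow> 0) (finite_subsets_at_top UNIV)"
    by simp
  then show ?thesis
    unfolding has_sum_def by (metis LIM_zero_cancel tendsto_norm_zero_iff)
qed

lemma bounded_operators_eqI:
  assumes "S \<in> bounded_operators" "T \<in> bounded_operators" "\<And>v. blinfun_apply S (ket v) = blinfun_apply T (ket v)"
  shows "S = T"
proof (rule blinfun_eqI)
  fix x
  have "((\<lambda>i. blinfun_apply R (coord x i *\<^sub>C ket i)) has_sum blinfun_apply R x) UNIV" for R :: "'a ell2 \<Rightarrow>\<^sub>L 'a ell2"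
    by (intro has_sum_bounded_linear[OF blinfun.bounded_linear_right] ket_expansion)
  from this[of S] this[of T] show "blinfun_apply S x = blinfun_apply T x"
    using assms by (simp add: bounded_operators_def has_sum_unique)
qed

lemma left_shift_exists:
  assumes "left_weight lam" "weight_sup lam w < \<infinity>"
  shows "\<exists>T. T \<in> bounded_operators \<and> (\<forall>v. blinfun_apply T (ket v) = lam v w *\<^sub>R ket (w @ v))"
proof -
  have pos: "0 < lam v w" for v using assms(1) by (simp add: left_weight_def)
  obtain c where c: "0 \<le> c" "weight_sup lam w = ennreal c"
    using assms(2) by (cases "weight_sup lam w") auto
  have le: "lam v w \<le> c" for v
  proof -
    have "ennreal (lam v w) \<le> ennreal c"
      unfolding c(2)[symmetric] weight_sup_def by (rule SUP_upper) simp
    then show ?thesis using c(1) by simp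
  qed
  define g where "g = (\<lambda>(x :: path \<Rightarrow> complex) u. if u \<in> range ((@) w)
      then of_real (lam (drop (length w) u) w) * x (drop (length w) u) else 0)"
  have inj: "inj ((@) w)" by (simp add: inj_def)
  have bnd: "(\<lambda>u. (cmod (g x u))\<^sup>2) summable_on UNIV \<and>
      (\<Sum>\<^sub>\<infinity>u. (cmod (g x u))\<^sup>2) \<le> c\<^sup>2 * (\<Sum>\<^sub>\<infinity>u. (cmod (x u))\<^sup>2)"
    if x: "(\<lambda>i. (cmod (x i))\<^sup>2) summable_on UNIV" for x
  proof -
    have cx: "(\<lambda>v. c\<^sup>2 * (cmod (x v))\<^sup>2) summable_on UNIV"
      using x by (rule summable_on_cmult_right)
    have pt: "(cmod (of_real (lam v w) * x v))\<^sup>2 \<le> c\<^sup>2 * (cmod (x v))\<^sup>2" for v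
      using pos[of v] le[of v] by (auto simp: norm_mult power_mult_distrib intro!: mult_right_mono power_mono)
    have s: "(\<lambda>v. (cmod (of_real (lam v w) * x v))\<^sup>2) summable_on UNIV"
      by (rule summable_on_comparison_test[OF cx]) (use pt in auto)
    then have "((\<lambda>v. (cmod (g x (w @ v)))\<^sup>2) has_sum (\<Sum>\<^sub>\<infinity>v. (cmod (of_real (lam v w) * x v))\<^sup>2)) UNIV"
      by (simp add: g_def)
    then have "((\<lambda>u. (cmod (g x u))\<^sup>2) has_sum (\<Sum>\<^sub>\<infinity>v. (cmod (of_real (lam v w) * x v))\<^sup>2)) (range ((@) w))"
      using has_sum_reindex[OF inj, of "\<lambda>u. (cmod (g x u))\<^sup>2"] by (simp add: o_def)
    then have h: "((\<lambda>u. (cmod (g x u))\<^sup>2) has_sum (\<Sum>\<^sub>\<infinity>v. (cmod (of_real (lam v w) * x v))\<^sup>2)) UNIV"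
      by (rule has_sum_cong_neutral[THEN iffD1, rotated -1]) (auto simp: g_def)
    have "(\<Sum>\<^sub>\<infinity>v. (cmod (of_real (lam v w) * x v))\<^sup>2) \<le> (\<Sum>\<^sub>\<infinity>v. c\<^sup>2 * (cmod (x v))\<^sup>2)"
      by (rule infsum_mono[OF s cx]) (rule pt)
    also have "\<dots> = c\<^sup>2 * (\<Sum>\<^sub>\<infinity>u. (cmod (x u))\<^sup>2)" by (rule infsum_cmult_right')
    finally show ?thesis using h has_sum_imp_summable[OF h] by (simp add: infsumI)
  qed
  define t where "t x = Abs_ell2 (g (coord x))" for x
  have t: "coord (t x) = g (coord x)" for x
    unfolding t_def using bnd[OF ell2_summable, of x] by (simp add: Abs_ell2_inverse)
  have "bounded_linear t"
  proof (rule bounded_linear_intro[of _ c])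
    fix x y :: "path ell2" and r :: real
    show "t (x + y) = t x + t y"
      by (rule ell2_eqI) (simp add: t plus_ell2.rep_eq g_def distrib_left)
    show "t (r *\<^sub>R x) = r *\<^sub>R t x"
      by (rule ell2_eqI) (simp add: t scaleR_ell2.rep_eq g_def)
    have "norm (t x) \<le> sqrt (c\<^sup>2 * (\<Sum>\<^sub>\<infinity>u. (cmod (coord x u))\<^sup>2))"
      using bnd[OF ell2_summable, of x] by (simp add: norm_ell2_def t)
    then show "norm (t x) \<le> norm x * c"
      using c(1) by (simp add: norm_ell2_def real_sqrt_mult mult.commute)
  qed
  then have T: "blinfun_apply (Blinfun t) = t" by (rule bounded_linear_Blinfun_apply)
  have "Blinfun t \<in> bounded_operators"
    unfolding bounded_operators_def
    by (auto intro!: ell2_eqI simp: T t cscale.rep_eq g_def)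
  moreover have "\<forall>v. blinfun_apply (Blinfun t) (ket v) = lam v w *\<^sub>R ket (w @ v)"
    unfolding T by (auto intro!: ell2_eqI simp: t scaleR_ell2.rep_eq ket.rep_eq g_def)
  ultimately show ?thesis by blast
qed

lemma left_shift:
  assumes "left_weight lam" "weight_sup lam w < \<infinity>"
  shows "left_shift lam w \<in> bounded_operators"
    and "blinfun_apply (left_shift lam w) (ket v) = lam v w *\<^sub>R ket (w @ v)"
proof -
  have "\<exists>!T. T \<in> bounded_operators \<and> (\<forall>v. blinfun_apply T (ket v) = lam v w *\<^sub>R ket (w @ v))"
    using left_shift_exists[OF assms] by (auto intro: bounded_operators_eqI)
  from theI'[OF this] show "left_shift lam w \<in> bounded_operators"
    and "blinfun_apply (left_shift lam w) (ket v) = lam v w *\<^sub>R ket (w @ v)"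
    unfolding left_shift_def by auto
qed

lemma recursive_path_weight_unique_exists:
  "\<exists>!\<alpha>. path_weight \<alpha> \<and> \<alpha> [E] = 1 \<and> \<alpha> [F] = 1 \<and>
     (\<forall>w. \<alpha> ([E] @ w @ [E]) = 1 / 2 * \<alpha> (w @ [E])) \<and>
     (\<forall>w. \<alpha> ([F] @ w @ [F]) = 1 / 2 * \<alpha> (w @ [F])) \<and>
     (\<forall>w. \<alpha> ([E] @ w @ [F]) = \<alpha> (w @ [F])) \<and>
     (\<forall>w. \<alpha> ([F] @ w @ [E]) = \<alpha> (w @ [E]))" (is "\<exists>!\<alpha>. ?P \<alpha>")
proof (rule ex_ex1I)
  define a :: "path \<Rightarrow> real" where
    "a = rec_list 1 (\<lambda>x xs r. (if xs \<noteq> [] \<and> last xs = x then 1 / 2 else 1) * r)"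
  have [simp]: "a [] = 1" "a (x # xs) = (if xs \<noteq> [] \<and> last xs = x then 1 / 2 else 1) * a xs" for x xs
    by (simp_all add: a_def)
  have "a v > 0" for v by (induction v) auto
  then have "?P a" by (auto simp: path_weight_def)
  then show "\<exists>\<alpha>. ?P \<alpha>" by blast
next
  fix a b assume a: "?P a" and b: "?P b"
  have "a v = b v" for v
  proof (induction v)
    case Nil
    then show ?case using a b by (simp add: path_weight_def)
  next
    case (Cons x xs)
    show ?case
    proof (cases xs rule: rev_cases)
      case Nil
      then show ?thesis using a b by (cases x) auto
    next
      case (snoc ys y)
      have "c (x # ys @ [y]) = (if x = y then 1 / 2 else 1) * c (ys @ [y])" if "?P c" for c
        using that by (cases x; cases y) auto
      from this[OF a] this[OF b] show ?thesis using Cons snoc by simp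
    qed
  qed
  then show "a = b" by (rule ext)
qed

end

theory Submission
  imports Defs
begin

text \<open>
  If \<open>T\<close> commutes with every \<open>L\<^sub>w\<close> and \<open>x = T \<xi>\<^sub>\<phi>\<close>, then
  \<open>\<lambda>(\<phi>,w) T \<xi>\<^bsub>w\<^esub> = L\<^sub>w x\<close>, so \<open>|x\<^sub>v| \<lambda>(v,w) \<le> \<lambda>(\<phi>,w) \<parallel>T\<parallel>\<close> for all \<open>v, w\<close>. For nonempty \<open>v\<close> take
  \<open>w = g\<^sup>n\<close> with \<open>g\<close> the edge different from the last letter of \<open>v\<close>: then \<open>\<lambda>(v,w) = 1\<close> while
  \<open>\<lambda>(\<phi>,w) = \<alpha>(w)\<close> decays like \<open>2\<^sup>-\<^sup>n\<close>, which forces \<open>x\<^sub>v = 0\<close>. So \<open>T\<close> is a scalar, the commutant is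
  trivial and the double commutant is everything. The algebra itself is proper because it leaves
  \<open>{\<xi>\<^sub>\<phi>}\<^sup>\<bottom>\<close> invariant.
\<close>

section \<open>Coordinates, basis vectors and matrix entries of the left shifts\<close>

lemma cmod_coord_le_norm: "cmod (coord x i) \<le> norm x"
proof -
  have "(\<Sum>\<^sub>\<infinity>j\<in>{i}. (cmod (coord x j))\<^sup>2) \<le> (\<Sum>\<^sub>\<infinity>j. (cmod (coord x j))\<^sup>2)"
    by (rule infsum_mono_neutral) (auto intro: ell2_summable)
  then show ?thesis
    unfolding norm_ell2_def by (intro real_le_rsqrt) simp
qed

lemma bounded_linear_coord: "bounded_linear (\<lambda>x. coord x i)"
  by (rule bounded_linear_intro[of _ 1])
    (simp_all add: plus_ell2.rep_eq scaleR_ell2.rep_eq scaleR_conv_of_real cmod_coord_le_norm)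

lemma norm_ket: "norm (ket v) = 1"
proof -
  have "(\<Sum>\<^sub>\<infinity>i. (cmod (coord (ket v) i))\<^sup>2) = (\<Sum>\<^sub>\<infinity>i\<in>{v}. (cmod (coord (ket v) i))\<^sup>2)"
    by (rule infsum_cong_neutral) (auto simp: ket.rep_eq)
  then show ?thesis by (simp add: norm_ell2_def ket.rep_eq)
qed

lemma cinner_ket: "cinner x (ket v) = coord x v"
proof -
  have "cinner x (ket v) = (\<Sum>\<^sub>\<infinity>i\<in>{v}. coord x i * cnj (coord (ket v) i))"
    unfolding cinner_def by (rule infsum_cong_neutral) (auto simp: ket.rep_eq)
  then show ?thesis by (simp add: ket.rep_eq)
qed

lemma bounded_operators_cscale:
  "T \<in> bounded_operators \<Longrightarrow> blinfun_apply T (c *\<^sub>C x) = c *\<^sub>C blinfun_apply T x"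
  by (simp add: bounded_operators_def)

text \<open>Continuity and complex homogeneity allow \<open>T\<close> to be applied termwise to the
  basis expansion of \<open>x\<close>.\<close>

lemma coord_operator_has_sum:
  assumes "T \<in> bounded_operators"
  shows "((\<lambda>i. coord x i * coord (blinfun_apply T (ket i)) u) has_sum
    coord (blinfun_apply T x) u) UNIV"
proof -
  have "((\<lambda>i. coord (blinfun_apply T (coord x i *\<^sub>C ket i)) u) has_sum
      coord (blinfun_apply T x) u) UNIV"
    by (rule has_sum_bounded_linear[OF bounded_linear_compose[OF bounded_linear_coord
          blinfun.bounded_linear_right] ket_expansion])
  then show ?thesis
    by (simp add: bounded_operators_cscale[OF assms] cscale.rep_eq)
qed

text \<open>Concatenation is left-cancellative, so among all \<open>ket i\<close> only
  \<open>ket v\<close> contributes to the coordinate \<open>w @ v\<close> and the sum has one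
  term.\<close>

lemma coord_left_shift:
  assumes "left_weight lam" "weight_sup lam w < \<infinity>"
  shows "coord (blinfun_apply (left_shift lam w) x) (w @ v) = lam v w * coord x v"
proof -
  let ?f = "\<lambda>i. coord x i * coord (blinfun_apply (left_shift lam w) (ket i)) (w @ v)"
  have "(?f has_sum ?f v) UNIV"
  proof (rule has_sum_cong_neutral[THEN iffD1, rotated -1])
    show "(?f has_sum ?f v) {v}"
      using has_sum_finite[of "{v}" ?f] by simp
  qed (auto simp: left_shift[OF assms] scaleR_ell2.rep_eq ket.rep_eq)
  from has_sum_unique[OF this coord_operator_has_sum[OF left_shift(1)[OF assms]]]
  show ?thesis
    by (simp add: left_shift[OF assms] scaleR_ell2.rep_eq ket.rep_eq mult.commute)
qed

lemma coord_left_shift_Nil: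
  assumes "left_weight lam" "weight_sup lam w < \<infinity>" "w \<noteq> []"
  shows "coord (blinfun_apply (left_shift lam w) x) [] = 0"
proof (rule has_sum_unique[OF coord_operator_has_sum[OF left_shift(1)[OF assms(1,2)]] has_sum_0])
  show "coord x i * coord (blinfun_apply (left_shift lam w) (ket i)) [] = 0" for i
    using assms(3) by (simp add: left_shift[OF assms(1,2)] scaleR_ell2.rep_eq ket.rep_eq)
qed

section \<open>The commutant consists of scalars\<close>

lemma generators_subset: "X \<subseteq> wot_closed_algebra_generated_by X"
  by (auto simp: wot_closed_algebra_generated_by_def)

text \<open>The weight enters only through one growth condition: for each nonempty \<open>v\<close>
  the ratio of \<open>lam v w\<close> to \<open>lam [] w\<close> is unbounded in
  \<open>w\<close>.\<close>

lemma commuting_with_left_shifts_scalar: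
  assumes lam: "left_weight lam" "left_bounded lam"
    and T: "T \<in> commutant (left_weighted_algebra lam)"
    and unbounded: "\<And>v C. v \<noteq> [] \<Longrightarrow> \<exists>w. lam v w > C * lam [] w"
  shows "\<exists>c. T = cscale_op c id_blinfun"
proof -
  have fin: "weight_sup lam w < \<infinity>" for w
    using lam(2) by (simp add: left_bounded_def)
  have pos: "lam v w > 0" for v w
    using lam(1) by (simp add: left_weight_def)
  have TB: "T \<in> bounded_operators"
    using T by (simp add: commutant_def)
  have comm: "T o\<^sub>L left_shift lam w = left_shift lam w o\<^sub>L T" for w
    using T fin[of w] generators_subset[of "{left_shift lam w | w. weight_sup lam w < \<infinity>}"]
    unfolding commutant_def left_weighted_algebra_def by blast
  define x where "x = blinfun_apply T (ket [])"
  have eq: "lam [] w *\<^sub>R blinfun_apply T (ket w) = blinfun_apply (left_shift lam w) x" for w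
    using arg_cong[OF comm[of w], of "\<lambda>S. blinfun_apply S (ket [])"]
    by (simp add: left_shift[OF lam(1) fin] blinfun.scaleR_right x_def)
  have x0: "coord x v = 0" if v: "v \<noteq> []" for v
  proof (rule ccontr)
    assume nz: "coord x v \<noteq> 0"
    \<comment> \<open>This constant contradicts the estimate
      \<open>lam v w * cmod (coord x v) \<le> lam [] w * norm T\<close> derived below.\<close>
    obtain w where w: "lam v w > norm T / cmod (coord x v) * lam [] w"
      using unbounded[OF v] by blast
    have "lam v w * cmod (coord x v)
        = cmod (coord (blinfun_apply (left_shift lam w) x) (w @ v))"
      using pos[of v w] by (simp add: coord_left_shift[OF lam(1) fin] norm_mult)
    also have "\<dots> = lam [] w * cmod (coord (blinfun_apply T (ket w)) (w @ v))"
      using pos[of "[]" w] by (simp add: eq[symmetric] scaleR_ell2.rep_eq norm_mult)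
    also have "\<dots> \<le> lam [] w * norm T"
    proof (rule mult_left_mono)
      show "cmod (coord (blinfun_apply T (ket w)) (w @ v)) \<le> norm T"
        using order_trans[OF cmod_coord_le_norm norm_blinfun[of T "ket w"]]
        by (simp add: norm_ket)
    qed (use pos[of "[]" w] in simp)
    finally show False
      using w nz by (simp add: field_simps)
  qed
  have x: "x = coord x [] *\<^sub>C ket []"
    by (rule ell2_eqI) (simp add: cscale.rep_eq ket.rep_eq x0)
  have "T = cscale_op (coord x []) id_blinfun"
  proof (rule bounded_operators_eqI[OF TB])
    show "cscale_op (coord x []) id_blinfun \<in> bounded_operators"
      by (auto simp: bounded_operators_def cscale_op_apply cscale.rep_eq intro!: ell2_eqI)
    fix w
    \<comment> \<open>Since \<open>x\<close> is a multiple of \<open>ket []\<close>,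
      \<open>eq\<close> determines \<open>T\<close> on every basis vector up to the positive factor
      \<open>lam [] w\<close>, which cancels.\<close>
    have "lam [] w *\<^sub>R blinfun_apply T (ket w) = coord x [] *\<^sub>C (lam [] w *\<^sub>R ket w)"
      using arg_cong[OF x, of "blinfun_apply (left_shift lam w)"]
      by (simp add: eq bounded_operators_cscale[OF left_shift(1)[OF lam(1) fin]]
          left_shift[OF lam(1) fin])
    also have "\<dots> = lam [] w *\<^sub>R (coord x [] *\<^sub>C ket w)"
      by (rule ell2_eqI) (simp add: cscale.rep_eq scaleR_ell2.rep_eq)
    finally have "lam [] w *\<^sub>R blinfun_apply T (ket w) = lam [] w *\<^sub>R (coord x [] *\<^sub>C ket w)" .
    then show "blinfun_apply T (ket w) = blinfun_apply (cscale_op (coord x []) id_blinfun) (ket w)"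
      using pos[of "[]" w] by (simp add: cscale_op_apply)
  qed
  then show ?thesis by blast
qed

lemma commutant_of_scalars:
  assumes "\<And>T. T \<in> X \<Longrightarrow> \<exists>c. T = cscale_op c id_blinfun"
  shows "commutant X = bounded_operators"
proof
  show "bounded_operators \<subseteq> commutant X"
  proof
    fix S :: "'a ell2 \<Rightarrow>\<^sub>L 'a ell2"
    assume S: "S \<in> bounded_operators"
    have "S o\<^sub>L T = T o\<^sub>L S" if "T \<in> X" for T
      using assms[OF that]
      by (auto intro!: blinfun_eqI simp: cscale_op_apply bounded_operators_cscale[OF S])
    then show "S \<in> commutant X"
      using S by (simp add: commutant_def)
  qed
qed (auto simp: commutant_def)

section \<open>An invariant subspace that makes the algebra proper\<close>

definition coord_kernel_stabilizer :: "'a \<Rightarrow> ('a ell2 \<Rightarrow>\<^sub>L 'a ell2) set" where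
  "coord_kernel_stabilizer v =
     {T \<in> bounded_operators. \<forall>x. coord x v = 0 \<longrightarrow> coord (blinfun_apply T x) v = 0}"

lemma unital_operator_algebra_bounded_operators:
  "unital_operator_algebra (bounded_operators :: ('a ell2 \<Rightarrow>\<^sub>L 'a ell2) set)"
proof -
  have "c *\<^sub>C (x + y) = c *\<^sub>C x + c *\<^sub>C y" "c *\<^sub>C (d *\<^sub>C x) = d *\<^sub>C (c *\<^sub>C x)"
    for c d and x y :: "'a ell2"
    by (rule ell2_eqI, simp add: plus_ell2.rep_eq cscale.rep_eq algebra_simps)+
  then show ?thesis
    by (simp add: unital_operator_algebra_def bounded_operators_def blinfun.add_left
        cscale_op_apply)
qed

lemma unital_operator_algebra_coord_kernel_stabilizer:
  "unital_operator_algebra (coord_kernel_stabilizer v)"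
  using unital_operator_algebra_bounded_operators
  unfolding unital_operator_algebra_def coord_kernel_stabilizer_def
  by (auto simp: blinfun.add_left cscale_op_apply plus_ell2.rep_eq cscale.rep_eq)

text \<open>Invariance of the orthogonal complement of \<open>ket v\<close> is the vanishing of
  certain matrix coefficients \<open>cinner (T x) (ket v)\<close>. It is thus the preimage of
  \<open>?C\<close>, which is closed in the product topology.\<close>

lemma closedin_coord_kernel_stabilizer:
  "closedin weak_operator_topology (coord_kernel_stabilizer v)"
proof -
  let ?f = "\<lambda>T :: 'a ell2 \<Rightarrow>\<^sub>L 'a ell2. \<lambda>(x, y). cinner (blinfun_apply T x) y"
  let ?C = "{g :: 'a ell2 \<times> 'a ell2 \<Rightarrow> complex. \<forall>x. coord x v = 0 \<longrightarrow> g (x, ket v) = 0}"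
  have "closed ?C"
    by (intro closed_Collect_all closed_Collect_imp closed_Collect_eq open_Collect_const
        continuous_on_product_coordinates continuous_on_const)
  then have "openin weak_operator_topology (?f -` (- ?C) \<inter> bounded_operators)"
    unfolding weak_operator_topology_def openin_pullback_topology by auto
  moreover have "topspace weak_operator_topology = (bounded_operators :: ('a ell2 \<Rightarrow>\<^sub>L 'a ell2) set)"
    unfolding weak_operator_topology_def topspace_pullback_topology by simp
  moreover have "bounded_operators - coord_kernel_stabilizer v
      = ?f -` (- ?C) \<inter> bounded_operators"
    by (auto simp: coord_kernel_stabilizer_def cinner_ket)
  moreover have "coord_kernel_stabilizer v \<subseteq> bounded_operators"
    by (auto simp: coord_kernel_stabilizer_def)
  ultimately show ?thesis
    by (simp add: closedin_def)
qed

text \<open>The stabilizer is one of the algebras being intersected once it contains the generators.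
  The empty path acts diagonally; any other shift never reaches the vertex.\<close>

lemma left_weighted_algebra_subset_stabilizer:
  assumes "left_weight lam"
  shows "left_weighted_algebra lam \<subseteq> coord_kernel_stabilizer []"
proof -
  have "left_shift lam w \<in> coord_kernel_stabilizer []" if w: "weight_sup lam w < \<infinity>" for w
  proof (cases "w = []")
    case True
    then show ?thesis
      using coord_left_shift[OF assms w, of _ "[]"] left_shift(1)[OF assms w]
      by (simp add: coord_kernel_stabilizer_def)
  next
    case False
    then show ?thesis
      using coord_left_shift_Nil[OF assms w] left_shift(1)[OF assms w]
      by (simp add: coord_kernel_stabilizer_def)
  qed
  then have "{left_shift lam w | w. weight_sup lam w < \<infinity>} \<subseteq> coord_kernel_stabilizer []"
    by auto
  then show ?thesis
    unfolding left_weighted_algebra_def wot_closed_algebra_generated_by_def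
    by (intro Inter_lower CollectI conjI unital_operator_algebra_coord_kernel_stabilizer
        closedin_coord_kernel_stabilizer)
qed

text \<open>The rank-one operator \<open>?t\<close> carries \<open>ket u\<close>, whose coordinate
  at \<open>v\<close> is zero, to \<open>ket v\<close>.\<close>

lemma coord_kernel_stabilizer_proper:
  assumes "u \<noteq> v"
  shows "coord_kernel_stabilizer v \<noteq> bounded_operators"
proof -
  let ?t = "\<lambda>x. coord x u *\<^sub>C ket v"
  have "bounded_linear ?t"
  proof (rule bounded_linear_intro[of _ 1])
    fix x y :: "'a ell2" and r :: real
    show "?t (x + y) = ?t x + ?t y"
      by (rule ell2_eqI) (simp add: plus_ell2.rep_eq cscale.rep_eq distrib_right)
    show "?t (r *\<^sub>R x) = r *\<^sub>R ?t x"
      by (rule ell2_eqI) (simp add: scaleR_ell2.rep_eq cscale.rep_eq)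
    have "coord (?t x) = (\<lambda>i. if i = v then coord x u else 0)"
      by (auto simp: cscale.rep_eq ket.rep_eq)
    then have "(\<Sum>\<^sub>\<infinity>i. (cmod (coord (?t x) i))\<^sup>2) = (\<Sum>\<^sub>\<infinity>i\<in>{v}. (cmod (coord x u))\<^sup>2)"
      by (intro infsum_cong_neutral) auto
    then have "norm (?t x) = cmod (coord x u)"
      by (simp add: norm_ell2_def)
    then show "norm (?t x) \<le> norm x * 1"
      using cmod_coord_le_norm[of x u] by simp
  qed
  then have T: "blinfun_apply (Blinfun ?t) = ?t"
    by (rule bounded_linear_Blinfun_apply)
  have "Blinfun ?t \<in> bounded_operators"
    by (auto simp: bounded_operators_def T cscale.rep_eq intro!: ell2_eqI)
  moreover have "Blinfun ?t \<notin> coord_kernel_stabilizer v"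
    using assms
    by (auto simp: coord_kernel_stabilizer_def T cscale.rep_eq ket.rep_eq intro!: exI[of _ "ket u"])
  ultimately show ?thesis by blast
qed

section \<open>Estimates for the recursive weight\<close>

locale last_edge_weight =
  fixes \<alpha> :: "path \<Rightarrow> real"
  assumes weight: "path_weight \<alpha>"
    and weight_Cons: "\<alpha> (x # v) = (if v \<noteq> [] \<and> last v = x then 1 / 2 else 1) * \<alpha> v"
begin

lemma weight_pos: "\<alpha> v > 0"
  using weight by (simp add: path_weight_def)

lemma weight_append_le: "\<alpha> (w @ v) \<le> \<alpha> v"
proof (induction w)
  case (Cons x w)
  then show ?case
    using weight_pos[of "w @ v"] weight_Cons[of x "w @ v"] by auto
qed simp

text \<open>Prepending letters never increases \<alpha>, so 1 bounds every quotient.\<close>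

lemma left_bounded_weight: "left_bounded (left_weight_of \<alpha>)"
  unfolding left_bounded_def
proof
  fix w
  have "ennreal (left_weight_of \<alpha> v w) \<le> 1" for v
    using weight_append_le[of w v] weight_pos[of v] by (simp add: left_weight_of_def)
  then have "weight_sup (left_weight_of \<alpha>) w \<le> 1"
    unfolding weight_sup_def by (rule SUP_least)
  also have "(1 :: ennreal) < \<infinity>" by simp
  finally show "weight_sup (left_weight_of \<alpha>) w < \<infinity>" .
qed

text \<open>The innermost letter is prepended to the empty path at no cost; each of the other
  \<open>n\<close> costs a factor 1/2.\<close>

lemma weight_power: "\<alpha> (replicate (Suc n) x) = (1 / 2) ^ n"
proof (induction n)
  case 0
  then show ?case
    using weight by (simp add: weight_Cons path_weight_def)
next
  case (Suc n)
  have "\<alpha> (replicate (Suc (Suc n)) x) = 1 / 2 * \<alpha> (replicate (Suc n) x)"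
    unfolding replicate_Suc[of "Suc n"] weight_Cons[of x "replicate (Suc n) x"] by simp
  then show ?case using Suc by simp
qed

text \<open>Prepending leaves the last letter of \<open>v\<close> in place, so no copy of
  \<open>x\<close> ever triggers a halving.\<close>

lemma weight_power_append:
  assumes "v \<noteq> []" "last v \<noteq> x"
  shows "\<alpha> (replicate n x @ v) = \<alpha> v"
  using assms by (induction n) (simp_all add: weight_Cons)

lemma left_weight_unbounded:
  assumes "v \<noteq> []"
  shows "\<exists>w. left_weight_of \<alpha> v w > C * left_weight_of \<alpha> [] w"
proof -
  obtain x where x: "last v \<noteq> x"
    by (metis edge.distinct(1))
  \<comment> \<open>The quotient of the two weights at \<open>?w\<close> will be exactly
    \<open>2 ^ n\<close>.\<close>
  obtain n where n: "C < 2 ^ n"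
    using real_arch_pow[of 2 C] by auto
  let ?w = "replicate (Suc n) x"
  have "left_weight_of \<alpha> v ?w = 1"
    using weight_power_append[OF assms x, of "Suc n"] weight_pos[of v]
    by (simp add: left_weight_of_def)
  moreover have "left_weight_of \<alpha> [] ?w = (1 / 2) ^ n"
    using weight_power[of n x] weight by (simp add: left_weight_of_def path_weight_def)
  ultimately have "left_weight_of \<alpha> v ?w > C * left_weight_of \<alpha> [] ?w"
    using n by (simp add: power_divide)
  then show ?thesis by blast
qed

end

theorem mainTheorem4:
  fixes \<alpha> :: "path \<Rightarrow> real" and lam :: "path \<Rightarrow> path \<Rightarrow> real"
  assumes "path_weight \<alpha>"
    and "\<alpha> [E] = 1" and "\<alpha> [F] = 1"
    and "\<And>w. \<alpha> ([E] @ w @ [E]) = 1 / 2 * \<alpha> (w @ [E])"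
    and "\<And>w. \<alpha> ([F] @ w @ [F]) = 1 / 2 * \<alpha> (w @ [F])"
    and "\<And>w. \<alpha> ([E] @ w @ [F]) = \<alpha> (w @ [F])"
    and "\<And>w. \<alpha> ([F] @ w @ [E]) = \<alpha> (w @ [E])"
    and "lam = left_weight_of \<alpha>"
  shows "left_bounded lam \<and>
    commutant (commutant (left_weighted_algebra lam)) = bounded_operators \<and>
    bounded_operators \<noteq> left_weighted_algebra lam"
proof -
  \<comment> \<open>The recursion fixes both end letters of the path; together its cases say that
    prepending a letter halves the weight exactly when it equals the last letter.\<close>
  interpret last_edge_weight \<alpha>
  proof
    fix x v
    show "\<alpha> (x # v) = (if v \<noteq> [] \<and> last v = x then 1 / 2 else 1) * \<alpha> v"
    proof (cases v rule: rev_cases)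
      case Nil
      then show ?thesis
        using assms(1-3) by (cases x) (simp_all add: path_weight_def)
    next
      case (snoc w y)
      then show ?thesis
        using assms(4-7)[of w] by (cases x; cases y) simp_all
    qed
  qed (rule assms(1))
  have lw: "left_weight lam"
    using left_weight_left_weight_of[OF assms(1)] assms(8) by simp
  have lb: "left_bounded lam"
    using left_bounded_weight assms(8) by simp
  have "\<exists>c. T = cscale_op c id_blinfun" if "T \<in> commutant (left_weighted_algebra lam)" for T
    using commuting_with_left_shifts_scalar[OF lw lb that] left_weight_unbounded
    unfolding assms(8) .
  then have "commutant (commutant (left_weighted_algebra lam)) = bounded_operators"
    by (rule commutant_of_scalars)
  \<comment> \<open>Equality would force the stabilizer at \<open>[]\<close> to be all of
    \<open>bounded_operators\<close>; \<open>[E]\<close> serves merely as a path other than the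
    vertex.\<close>
  moreover have "bounded_operators \<noteq> left_weighted_algebra lam"
    using left_weighted_algebra_subset_stabilizer[OF lw]
      coord_kernel_stabilizer_proper[of "[E]" "[]"]
    unfolding coord_kernel_stabilizer_def by blast
  ultimately show ?thesis
    using lb by simp
qed

end
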